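(* Let $n\ge1$ and $d\ge 0$ be integers, let $a<b$ be real numbers, and let $P\in\mathbb{S}^{\frac n2(d+1)(d+4)}$ be positive semidefinite, partitioned as $$P=\begin{bmatrix}P_{11}&P_{12}\\P_{21}&P_{22}\end{bmatrix},\qquad P_{11}\in\mathbb{S}^{n(d+1)}.$$ Define $Z_1(x)=Z_d(x)\otimes I_n$ and $Z_2(x,y)=Z_d(x,y)\otimes I_n$ for $x,y\in(a,b)$. If for some $\epsilon>0$ $$M(x)=Z_1(x)^TP_{11}Z_1(x)+\epsilon I_n,$$ $$N(x,y)=Z_1(x)^TP_{12}Z_2(x,y)+Z_2(y,x)^TP_{21}Z_1(y)+\int_a^bZ_2(z,x)^TP_{22}Z_2(z,y)\,dz,$$ then the functional $V:L_2^n(a,b)\to\mathbb{R}$ defined by $$V(w)=\int_a^bw(x)^TM(x)w(x)\,dx+\int_a^bw(x)^T\int_a^bN(x,y)w(y)\,dy\,dx$$ satisfies $V(w)\ge\epsilon\|w\|_{L_2^n}^2$ for all $w\in L_2^n(a,b)$.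
   Context: $\mathbb{S}^k$ is the set of real symmetric $k\times k$ matrices, $I_n$ the $n\times n$ identity, $\otimes$ the Kronecker product. $L_2^n(a,b)$ is the Hilbert space of square integrable functions $(a,b)\to\mathbb{R}^n$ with norm $\|w\|_{L_2^n}=\left(\int_a^bw(x)^Tw(x)\,dx\right)^{1/2}$. $Z_d(x)$ is the column vector of all monomials in $x$ of degree at most $d$ (length $d+1$), and $Z_d(x,y)$ is the column vector of all monomials in $(x,y)$ of total degree at most $d$ (length $(d+1)(d+2)/2$). *)

theory Defs
  imports "HOL-Analysis.Analysis" "Jordan_Normal_Form.Matrix"
begin

definition sym_mats :: "nat \<Rightarrow> real mat set" where
  "sym_mats k = {A \<in> carrier_mat k k. transpose_mat A = A}"

definition pos_semidef :: "real mat \<Rightarrow> bool" where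
  "pos_semidef A \<longleftrightarrow> (\<forall>v \<in> carrier_vec (dim_row A). 0 \<le> scalar_prod v (A *\<^sub>v v))"

definition kronecker :: "real mat \<Rightarrow> real mat \<Rightarrow> real mat" (infixl \<open>\<otimes>\<^sub>K\<close> 70) where
  "A \<otimes>\<^sub>K B = Matrix.mat (dim_row A * dim_row B) (dim_col A * dim_col B)
     (\<lambda>(i, j). A $$ (i div dim_row B, j div dim_col B) * B $$ (i mod dim_row B, j mod dim_col B))"

definition monomials1 :: "nat \<Rightarrow> real \<Rightarrow> real mat" where
  "monomials1 d x = Matrix.mat (d + 1) 1 (\<lambda>(i, _). x ^ i)"

text \<open>Monomials in two variables are listed by increasing total degree and, within one degree, by
  decreasing exponent of the first variable: \<open>1, x, y, x\<^sup>2, x y, y\<^sup>2, \<dots>\<close>\<close>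

definition exponents2 :: "nat \<Rightarrow> (nat \<times> nat) list" where
  "exponents2 d = concat (map (\<lambda>k. map (\<lambda>j. (k - j, j)) [0..<k + 1]) [0..<d + 1])"

definition monomials2 :: "nat \<Rightarrow> real \<Rightarrow> real \<Rightarrow> real mat" where
  "monomials2 d x y = Matrix.mat (length (exponents2 d)) 1
     (\<lambda>(i, _). x ^ fst (exponents2 d ! i) * y ^ snd (exponents2 d ! i))"

lemma length_exponents2: "length (exponents2 d) = (d + 1) * (d + 2) div 2"
  by (induction d) (simp_all add: exponents2_def)

lemma set_exponents2: "set (exponents2 d) = {(i, j). i + j \<le> d}"
proof -
  have *: "set (exponents2 d) = (\<Union>k\<in>{0..<d+1}. (\<lambda>j. (k - j, j)) ` {0..<k+1})"
    unfolding exponents2_def set_concat set_map set_upt image_image by (rule refl)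
  have "p \<in> set (exponents2 d) \<longleftrightarrow> fst p + snd p \<le> d" for p
  proof
    assume "p \<in> set (exponents2 d)"
    then obtain k j where "k < d + 1" "j < k + 1" "p = (k - j, j)"
      unfolding * by (elim UN_E imageE) simp
    then show "fst p + snd p \<le> d" by simp
  next
    assume "fst p + snd p \<le> d"
    then show "p \<in> set (exponents2 d)"
      unfolding * by (intro UN_I[of "fst p + snd p"] image_eqI[of _ _ "snd p"]) simp_all
  qed
  then show ?thesis by auto
qed

lemma distinct_exponents2: "distinct (exponents2 d)"
proof (rule card_distinct)
  have "{(i, j). i + j \<le> d} = (SIGMA i:{..d}. {..d - i})"
    by auto
  then have "card (set (exponents2 d)) = (\<Sum>i\<le>d. d - i + 1)"
    by (simp add: set_exponents2)
  also have "\<dots> = (\<Sum>i\<le>d. i + 1)"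
    by (rule sum.reindex_bij_witness[where i = "\<lambda>i. d - i" and j = "\<lambda>i. d - i"]) auto
  also have "\<dots> = (d + 1) * (d + 2) div 2"
    by (induction d) simp_all
  finally show "card (set (exponents2 d)) = length (exponents2 d)"
    by (simp add: length_exponents2)
qed

definition Z1 :: "nat \<Rightarrow> nat \<Rightarrow> real \<Rightarrow> real mat" where
  "Z1 n d x = monomials1 d x \<otimes>\<^sub>K 1\<^sub>m n"

definition Z2 :: "nat \<Rightarrow> nat \<Rightarrow> real \<Rightarrow> real \<Rightarrow> real mat" where
  "Z2 n d x y = monomials2 d x y \<otimes>\<^sub>K 1\<^sub>m n"

text \<open>Vector- and matrix-valued integrals are taken entrywise. The dimensions are explicit arguments
  because they are not part of the type of the integrand.\<close>

definition vec_integral :: "nat \<Rightarrow> real \<Rightarrow> real \<Rightarrow> (real \<Rightarrow> real vec) \<Rightarrow> real vec" where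
  "vec_integral m a b f =
     Matrix.vec m (\<lambda>i. LINT x : {a<..<b} | lebesgue. vec_index (f x) i)"

definition mat_integral :: "nat \<Rightarrow> nat \<Rightarrow> real \<Rightarrow> real \<Rightarrow> (real \<Rightarrow> real mat) \<Rightarrow> real mat" where
  "mat_integral r c a b F =
     Matrix.mat r c (\<lambda>(i, j). LINT x : {a<..<b} | lebesgue. F x $$ (i, j))"

text \<open>Elements of \<open>L\<^sub>2\<close> are represented by functions, without identifying functions that agree almost
  everywhere. Values outside the interval are unconstrained.\<close>

definition L2_space :: "nat \<Rightarrow> real \<Rightarrow> real \<Rightarrow> (real \<Rightarrow> real vec) set" where
  "L2_space n a b = {w.
     (\<forall>x \<in> {a<..<b}. w x \<in> carrier_vec n) \<and>
     (\<forall>i < n. set_borel_measurable lebesgue {a<..<b} (\<lambda>x. vec_index (w x) i)) \<and>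
     set_integrable lebesgue {a<..<b} (\<lambda>x. scalar_prod (w x) (w x))}"

definition L2_norm :: "real \<Rightarrow> real \<Rightarrow> (real \<Rightarrow> real vec) \<Rightarrow> real" where
  "L2_norm a b w = sqrt (LINT x : {a<..<b} | lebesgue. scalar_prod (w x) (w x))"

definition quadratic_functional ::
  "nat \<Rightarrow> real \<Rightarrow> real \<Rightarrow> (real \<Rightarrow> real mat) \<Rightarrow> (real \<Rightarrow> real \<Rightarrow> real mat) \<Rightarrow> (real \<Rightarrow> real vec) \<Rightarrow> real" where
  "quadratic_functional n a b M N w =
     (LINT x : {a<..<b} | lebesgue. scalar_prod (w x) (M x *\<^sub>v w x)) +
     (LINT x : {a<..<b} | lebesgue.
        scalar_prod (w x) (vec_integral n a b (\<lambda>y. N x y *\<^sub>v w y)))"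

end

theory Submission
  imports Defs
begin

text \<open>
  For \<open>w\<close> in \<open>L\<^sub>2\<close> put \<open>u(z) = Z\<^sub>1(z) w(z)\<close> and \<open>v(z) = \<integral> Z\<^sub>2(z,y) w(y) dy\<close>. The stacked vector of \<open>u(z)\<close>
  and \<open>v(z)\<close> makes the quadratic form of \<open>P\<close> nonnegative at every \<open>z\<close>, so its integral

  \<open>\<integral> u\<^sup>T P\<^sub>1\<^sub>1 u + u\<^sup>T P\<^sub>1\<^sub>2 v + v\<^sup>T P\<^sub>2\<^sub>1 u + v\<^sup>T P\<^sub>2\<^sub>2 v dz\<close>

  is nonnegative too. The theorem holds because this integral is exactly \<open>V(w) - \<epsilon> \<parallel>w\<parallel>\<^sup>2\<close>. The first term
  is the multiplier part of \<open>V\<close> apart from \<open>\<epsilon> I\<close>, and the second is the \<open>P\<^sub>1\<^sub>2\<close> part of the kernel. The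
  last two agree with the \<open>P\<^sub>2\<^sub>1\<close> and \<open>P\<^sub>2\<^sub>2\<close> parts of the kernel only after the order of integration has
  been exchanged.

  This exchange is elementary, because every entry of \<open>Z\<^sub>1\<close> and \<open>Z\<^sub>2\<close> is a monomial. The kernel is a
  finite sum of products of a function of \<open>x\<close> and a function of \<open>y\<close> (lemma
  \<open>separable_kernel_form\<close>), so both iterated integrals reduce to the same finite sum of products of
  the moments \<open>J k i = \<integral> y\<^sup>k w\<^sub>i(y) dy\<close> and \<open>S k = \<integral> z\<^sup>k dz\<close> (lemma \<open>set_integral_double_sum\<close>). The
  moments exist because the interval is bounded and \<open>w\<close> is square integrable (lemmas
  \<open>power_set_integrable\<close> and \<open>L2_components\<close>).
\<close>

unbundle no vec_syntax
unbundle no inner_syntax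

section \<open>Bilinear forms of block and Kronecker matrices\<close>

lemma scalar_prod_mult_mat_vec:
  fixes A :: "real mat"
  assumes "A \<in> carrier_mat r s" "u \<in> carrier_vec r" "v \<in> carrier_vec s"
  shows "u \<bullet> (A *\<^sub>v v) = (\<Sum>p<r. \<Sum>q<s. A $$ (p, q) * (u $ p * v $ q))"
proof -
  have "u \<bullet> (A *\<^sub>v v) = (\<Sum>p<r. u $ p * (\<Sum>q<s. A $$ (p, q) * v $ q))"
    using assms by (auto simp: scalar_prod_def atLeast0LessThan intro!: sum.cong)
  then show ?thesis
    by (simp add: sum_distrib_left mult_ac)
qed

text \<open>
  Moving \<open>X\<close> across the scalar product leaves the form of \<open>A\<close> alone at \<open>X v\<close> and \<open>Y u\<close>. It is stated as
  a sum over the entries of \<open>A\<close>, which are constants, so that integration only meets products of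
  entries of \<open>X v\<close> and \<open>Y u\<close>.
\<close>

lemma scalar_prod_congruence:
  fixes A X Y :: "real mat"
  assumes "A \<in> carrier_mat r s" "X \<in> carrier_mat r n" "Y \<in> carrier_mat s n"
    and "v \<in> carrier_vec n" "u \<in> carrier_vec n"
  shows "v \<bullet> ((transpose_mat X * A * Y) *\<^sub>v u) =
    (\<Sum>p<r. \<Sum>q<s. A $$ (p, q) * ((X *\<^sub>v v) $ p * (Y *\<^sub>v u) $ q))"
proof -
  have "(transpose_mat X * A * Y) *\<^sub>v u = transpose_mat X *\<^sub>v (A *\<^sub>v (Y *\<^sub>v u))"
    using assms by (subst assoc_mult_mat_vec[where n\<^sub>2 = s], auto)+
  moreover have "v \<bullet> (transpose_mat X *\<^sub>v (A *\<^sub>v (Y *\<^sub>v u)))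
      = (transpose_mat X *\<^sub>v (A *\<^sub>v (Y *\<^sub>v u))) \<bullet> v"
    using assms by (intro comm_scalar_prod[where n = n]) auto
  moreover have "\<dots> = (A *\<^sub>v (Y *\<^sub>v u)) \<bullet> (X *\<^sub>v v)"
    using assms by (intro transpose_vec_mult_scalar[where nr = r and nc = n]) auto
  moreover have "\<dots> = (X *\<^sub>v v) \<bullet> (A *\<^sub>v (Y *\<^sub>v u))"
    using assms by (intro comm_scalar_prod[where n = r]) auto
  moreover have "\<dots> = (\<Sum>p<r. \<Sum>q<s. A $$ (p, q) * ((X *\<^sub>v v) $ p * (Y *\<^sub>v u) $ q))"
    using assms by (intro scalar_prod_mult_mat_vec) auto
  ultimately show ?thesis by simp
qed

lemma pos_semidef_four_block:
  assumes "pos_semidef (four_block_mat A B C D)"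
    and "A \<in> carrier_mat r r" "B \<in> carrier_mat r s" "C \<in> carrier_mat s r" "D \<in> carrier_mat s s"
    and "u \<in> carrier_vec r" "v \<in> carrier_vec s"
  shows "0 \<le> u \<bullet> (A *\<^sub>v u) + u \<bullet> (B *\<^sub>v v) + v \<bullet> (C *\<^sub>v u) + v \<bullet> (D *\<^sub>v v)"
proof -
  let ?P = "four_block_mat A B C D"
  have "u @\<^sub>v v \<in> carrier_vec (dim_row ?P)"
    using assms by simp
  then have "0 \<le> (u @\<^sub>v v) \<bullet> (?P *\<^sub>v (u @\<^sub>v v))"
    using assms(1) unfolding pos_semidef_def by blast
  also have "?P *\<^sub>v (u @\<^sub>v v) = (A *\<^sub>v u + B *\<^sub>v v) @\<^sub>v (C *\<^sub>v u + D *\<^sub>v v)"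
    by (rule four_block_mat_mult_vec) (use assms in auto)
  also have "(u @\<^sub>v v) \<bullet> \<dots> = u \<bullet> (A *\<^sub>v u + B *\<^sub>v v) + v \<bullet> (C *\<^sub>v u + D *\<^sub>v v)"
    by (rule scalar_prod_append) (use assms in auto)
  also have "\<dots> = u \<bullet> (A *\<^sub>v u) + u \<bullet> (B *\<^sub>v v) + (v \<bullet> (C *\<^sub>v u) + v \<bullet> (D *\<^sub>v v))"
    using assms by (simp add: scalar_prod_add_distrib[where n = r] scalar_prod_add_distrib[where n = s])
  finally show ?thesis by simp
qed

text \<open>
  \<open>E \<otimes> I\<^sub>n\<close> stacks the blocks \<open>E\<^sub>k I\<^sub>n\<close>. Row \<open>p\<close> therefore belongs to entry \<open>p div n\<close> of the column \<open>E\<close> and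
  selects component \<open>p mod n\<close> of the vector.
\<close>

lemma column_kronecker_one:
  assumes "E \<in> carrier_mat m 1"
  shows "E \<otimes>\<^sub>K 1\<^sub>m n \<in> carrier_mat (n * m) n"
    and "v \<in> carrier_vec n \<Longrightarrow> p < n * m \<Longrightarrow>
      ((E \<otimes>\<^sub>K 1\<^sub>m n) *\<^sub>v v) $ p = E $$ (p div n, 0) * v $ (p mod n)"
proof -
  show carrier: "E \<otimes>\<^sub>K 1\<^sub>m n \<in> carrier_mat (n * m) n"
    using assms by (simp add: kronecker_def mult.commute)
  assume v: "v \<in> carrier_vec n" and p: "p < n * m"
  then have "n > 0" by (cases n) auto
  then have mod: "p mod n < n" by simp
  have "((E \<otimes>\<^sub>K 1\<^sub>m n) *\<^sub>v v) $ p = (\<Sum>j<n. (E \<otimes>\<^sub>K 1\<^sub>m n) $$ (p, j) * v $ j)"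
    using carrier v p by (auto simp: scalar_prod_def atLeast0LessThan intro!: sum.cong)
  also have "\<dots> = (\<Sum>j<n. if p mod n = j then E $$ (p div n, 0) * v $ j else 0)"
    using assms p mod by (intro sum.cong) (auto simp: kronecker_def mult.commute)
  also have "\<dots> = E $$ (p div n, 0) * v $ (p mod n)"
    using mod by (simp add: sum.delta)
  finally show "((E \<otimes>\<^sub>K 1\<^sub>m n) *\<^sub>v v) $ p = E $$ (p div n, 0) * v $ (p mod n)" .
qed

lemma Z1_carrier: "Z1 n d x \<in> carrier_mat (n * (d + 1)) n"
  unfolding Z1_def by (intro column_kronecker_one) (simp add: monomials1_def)

lemma Z2_carrier: "Z2 n d x y \<in> carrier_mat (n * length (exponents2 d)) n"
  unfolding Z2_def by (intro column_kronecker_one) (simp add: monomials2_def)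

lemma Z1_mult_vec:
  assumes "v \<in> carrier_vec n" "p < n * (d + 1)"
  shows "(Z1 n d x *\<^sub>v v) $ p = x ^ (p div n) * v $ (p mod n)"
proof -
  have "p div n < d + 1"
    using assms(2) by (intro less_mult_imp_div_less) (simp add: mult.commute)
  then show ?thesis
    unfolding Z1_def using assms
    by (subst column_kronecker_one(2)[where m = "d + 1"]) (auto simp: monomials1_def)
qed

lemma Z2_mult_vec:
  assumes "v \<in> carrier_vec n" "q < n * length (exponents2 d)"
  shows "(Z2 n d x y *\<^sub>v v) $ q =
    x ^ fst (exponents2 d ! (q div n)) * y ^ snd (exponents2 d ! (q div n)) * v $ (q mod n)"
proof -
  have "q div n < length (exponents2 d)"
    using assms(2) by (intro less_mult_imp_div_less) (simp add: mult.commute)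
  then show ?thesis
    unfolding Z2_def using assms
    by (subst column_kronecker_one(2)[where m = "length (exponents2 d)"]) (auto simp: monomials2_def)
qed

section \<open>Integrals of matrix forms\<close>

text \<open>
  The constants \<open>c\<close> carry the entries of a block of \<open>P\<close>, together with any variable or moment that the
  integration leaves fixed.
\<close>

lemma set_integral_double_sum:
  fixes f :: "nat \<Rightarrow> nat \<Rightarrow> 'a \<Rightarrow> real"
  assumes "\<And>p q. p < r \<Longrightarrow> q < s \<Longrightarrow> set_integrable M A (f p q)"
  shows "set_integrable M A (\<lambda>x. \<Sum>p<r. \<Sum>q<s. c p q * f p q x)"
    and "(LINT x:A|M. \<Sum>p<r. \<Sum>q<s. c p q * f p q x) =
      (\<Sum>p<r. \<Sum>q<s. c p q * (LINT x:A|M. f p q x))"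
proof -
  have *: "(\<lambda>x. indicator A x *\<^sub>R (\<Sum>p<r. \<Sum>q<s. c p q * f p q x)) =
      (\<lambda>x. \<Sum>p<r. \<Sum>q<s. c p q * (indicator A x *\<^sub>R f p q x))"
    by (auto simp: sum_distrib_left mult_ac intro!: sum.cong)
  have int: "integrable M (\<lambda>x. c p q * (indicator A x *\<^sub>R f p q x))" if "p < r" "q < s" for p q
    using assms[OF that] unfolding set_integrable_def by (rule integrable_mult_right)
  show "set_integrable M A (\<lambda>x. \<Sum>p<r. \<Sum>q<s. c p q * f p q x)"
    unfolding set_integrable_def * using int by (intro Bochner_Integration.integrable_sum) auto
  have "(\<integral>x. (\<Sum>p<r. \<Sum>q<s. c p q * (indicator A x *\<^sub>R f p q x)) \<partial>M) =
      (\<Sum>p<r. \<integral>x. (\<Sum>q<s. c p q * (indicator A x *\<^sub>R f p q x)) \<partial>M)"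
    using int by (intro Bochner_Integration.integral_sum Bochner_Integration.integrable_sum) auto
  also have "\<dots> = (\<Sum>p<r. \<Sum>q<s. \<integral>x. c p q * (indicator A x *\<^sub>R f p q x) \<partial>M)"
    using int by (intro sum.cong refl Bochner_Integration.integral_sum) auto
  also have "\<dots> = (\<Sum>p<r. \<Sum>q<s. c p q * (\<integral>x. indicator A x *\<^sub>R f p q x \<partial>M))"
    by simp
  finally show "(LINT x:A|M. \<Sum>p<r. \<Sum>q<s. c p q * f p q x) =
      (\<Sum>p<r. \<Sum>q<s. c p q * (LINT x:A|M. f p q x))"
    unfolding set_lebesgue_integral_def * .
qed

text \<open>
  A matrix-valued integral commutes with bilinear forms. Integrability is required of the forms
  rather than of the entries, since the forms are what has a closed expression below; unit vectors
  recover the entries.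
\<close>

lemma scalar_prod_mat_integral:
  assumes "\<And>z. z \<in> {a<..<b} \<Longrightarrow> F z \<in> carrier_mat r s"
    and int: "\<And>u v. u \<in> carrier_vec r \<Longrightarrow> v \<in> carrier_vec s \<Longrightarrow>
      set_integrable lebesgue {a<..<b} (\<lambda>z. u \<bullet> (F z *\<^sub>v v))"
    and "u \<in> carrier_vec r" "v \<in> carrier_vec s"
  shows "u \<bullet> (mat_integral r s a b F *\<^sub>v v) = (LINT z:{a<..<b}|lebesgue. u \<bullet> (F z *\<^sub>v v))"
proof -
  have entry: "set_integrable lebesgue {a<..<b} (\<lambda>z. F z $$ (i, j))" if "i < r" "j < s" for i j
  proof -
    have "set_integrable lebesgue {a<..<b} (\<lambda>z. unit_vec r i \<bullet> (F z *\<^sub>v unit_vec s j))"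
      by (intro int) auto
    also have "?this \<longleftrightarrow> ?thesis"
    proof (intro set_integrable_cong refl)
      fix z assume "z \<in> {a<..<b}"
      then have F: "F z \<in> carrier_mat r s" by (rule assms(1))
      then show "unit_vec r i \<bullet> (F z *\<^sub>v unit_vec s j) = F z $$ (i, j)"
        using that by (subst scalar_prod_left_unit[where n = r])
          (auto simp: scalar_prod_right_unit[where n = s])
    qed
    finally show ?thesis .
  qed
  have "u \<bullet> (mat_integral r s a b F *\<^sub>v v) =
      (\<Sum>i<r. \<Sum>j<s. (u $ i * v $ j) * (LINT z:{a<..<b}|lebesgue. F z $$ (i, j)))"
    using assms by (subst scalar_prod_mult_mat_vec) (auto simp: mat_integral_def intro!: sum.cong)
  also have "\<dots> = (LINT z:{a<..<b}|lebesgue. \<Sum>i<r. \<Sum>j<s. (u $ i * v $ j) * F z $$ (i, j))"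
    using entry by (subst set_integral_double_sum(2)) auto
  also have "\<dots> = (LINT z:{a<..<b}|lebesgue. u \<bullet> (F z *\<^sub>v v))"
    using assms
    by (intro set_lebesgue_integral_cong ballI allI impI)
      (auto simp: scalar_prod_mult_mat_vec[where r = r and s = s] mult.commute)
  finally show ?thesis .
qed

lemma scalar_prod_vec_integral:
  assumes "\<And>y. y \<in> {a<..<b} \<Longrightarrow> f y \<in> carrier_vec n"
    and int: "\<And>v. v \<in> carrier_vec n \<Longrightarrow> set_integrable lebesgue {a<..<b} (\<lambda>y. v \<bullet> f y)"
    and "v \<in> carrier_vec n"
  shows "v \<bullet> vec_integral n a b f = (LINT y:{a<..<b}|lebesgue. v \<bullet> f y)"
proof -
  have entry: "set_integrable lebesgue {a<..<b} (\<lambda>y. f y $ i)" if "i < n" for i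
  proof -
    have "set_integrable lebesgue {a<..<b} (\<lambda>y. unit_vec n i \<bullet> f y)"
      by (intro int) auto
    also have "?this \<longleftrightarrow> ?thesis"
      using assms(1) that by (intro set_integrable_cong refl) auto
    finally show ?thesis .
  qed
  have "v \<bullet> vec_integral n a b f =
      (\<Sum>i<n. \<Sum>j<1::nat. v $ i * (LINT y:{a<..<b}|lebesgue. f y $ i))"
    using assms(3) by (auto simp: vec_integral_def scalar_prod_def atLeast0LessThan)
  also have "\<dots> = (LINT y:{a<..<b}|lebesgue. \<Sum>i<n. \<Sum>j<1::nat. v $ i * f y $ i)"
    using entry by (subst set_integral_double_sum(2)) auto
  also have "\<dots> = (LINT y:{a<..<b}|lebesgue. v \<bullet> f y)"
    using assms(1)
    by (intro set_lebesgue_integral_cong ballI allI impI)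
      (auto simp: scalar_prod_def atLeast0LessThan dest!: carrier_vecD)
  finally show ?thesis .
qed

section \<open>Existence of moments\<close>

lemma power_set_integrable:
  fixes a b :: real
  assumes "set_integrable lebesgue {a<..<b} g"
  shows "set_integrable lebesgue {a<..<b} (\<lambda>x. x ^ k * g x)"
proof -
  define C where "C = max \<bar>a\<bar> \<bar>b\<bar> ^ k"
  have "set_integrable lebesgue {a<..<b} (\<lambda>x. C * g x)"
    using assms by simp
  then show ?thesis
  proof (rule set_integrable_bound)
    have "(\<lambda>x. x ^ k * (indicator {a<..<b} x *\<^sub>R g x)) \<in> borel_measurable lebesgue"
      using assms unfolding set_integrable_def
      by (intro borel_measurable_times borel_measurable_integrable[of _ "\<lambda>x. indicator {a<..<b} x *\<^sub>R g x"]
          measurable_completion[of "\<lambda>x. x ^ k"]) simp_all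
    then show "set_borel_measurable lebesgue {a<..<b} (\<lambda>x. x ^ k * g x)"
      unfolding set_borel_measurable_def by (simp add: mult_ac)
    have "\<bar>x ^ k * g x\<bar> \<le> \<bar>C * g x\<bar>" if "x \<in> {a<..<b}" for x
    proof -
      have "\<bar>x\<bar> ^ k \<le> C"
        unfolding C_def using that by (intro power_mono) auto
      then show ?thesis
        by (auto simp: abs_mult power_abs intro!: mult_right_mono)
    qed
    then show "AE x in lebesgue. x \<in> {a<..<b} \<longrightarrow> norm (x ^ k * g x) \<le> norm (C * g x)"
      by auto
  qed
qed

lemma set_integrable_one: "set_integrable lebesgue {a<..<b::real} (\<lambda>x. 1::real)"
  unfolding set_integrable_def
  by (cases "a \<le> b") (auto intro!: integrable_real_indicator)

text \<open>
  Both bounds are the arithmetic-geometric mean inequality: \<open>\<bar>w\<^sub>i\<bar> \<le> 1 + w\<^sup>T w\<close> and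
  \<open>\<bar>w\<^sub>i w\<^sub>j\<bar> \<le> w\<^sup>T w\<close>. The constant function \<open>1\<close> is integrable because the interval is bounded.
\<close>

lemma L2_components:
  assumes w: "w \<in> L2_space n a b"
  shows L2_component_integrable:
      "i < n \<Longrightarrow> set_integrable lebesgue {a<..<b} (\<lambda>x. w x $ i)"
    and L2_component_product_integrable:
      "i < n \<Longrightarrow> j < n \<Longrightarrow> set_integrable lebesgue {a<..<b} (\<lambda>x. w x $ i * w x $ j)"
proof -
  have carrier: "\<And>x. x \<in> {a<..<b} \<Longrightarrow> w x \<in> carrier_vec n"
    and meas: "\<And>i. i < n \<Longrightarrow> set_borel_measurable lebesgue {a<..<b} (\<lambda>x. w x $ i)"
    and sq: "set_integrable lebesgue {a<..<b} (\<lambda>x. w x \<bullet> w x)"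
    using w unfolding L2_space_def by auto
  have le: "(w x $ i)\<^sup>2 \<le> w x \<bullet> w x" if "x \<in> {a<..<b}" "i < n" for x i
    unfolding scalar_prod_def using carrier[OF that(1)] that(2)
    by (auto simp: power2_eq_square intro!: member_le_sum[of i "{0..<n}" "\<lambda>i. w x $ i * w x $ i"])
  have bound: "set_integrable lebesgue {a<..<b} (\<lambda>x. 1 + w x \<bullet> w x)"
    using set_integrable_one sq by (intro set_integral_add)
  show "set_integrable lebesgue {a<..<b} (\<lambda>x. w x $ i)" if i: "i < n"
  proof (rule set_integrable_bound[OF bound meas[OF i]])
    have "\<bar>w x $ i\<bar> \<le> \<bar>1 + w x \<bullet> w x\<bar>" if "x \<in> {a<..<b}" for x
    proof -
      have "2 * \<bar>w x $ i\<bar> \<le> 1 + (w x $ i)\<^sup>2"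
        using sum_squares_bound[of 1 "\<bar>w x $ i\<bar>"] by simp
      then show ?thesis using le[OF that i] by linarith
    qed
    then show "AE x in lebesgue. x \<in> {a<..<b} \<longrightarrow> norm (w x $ i) \<le> norm (1 + w x \<bullet> w x)"
      by auto
  qed
  show "set_integrable lebesgue {a<..<b} (\<lambda>x. w x $ i * w x $ j)" if i: "i < n" and j: "j < n"
  proof (rule set_integrable_bound[OF sq])
    have "(\<lambda>x. (indicator {a<..<b} x *\<^sub>R w x $ i) * (indicator {a<..<b} x *\<^sub>R w x $ j))
        \<in> borel_measurable lebesgue"
      using meas i j unfolding set_borel_measurable_def by (intro borel_measurable_times)
    also have "(\<lambda>x. (indicator {a<..<b} x *\<^sub>R w x $ i) * (indicator {a<..<b} x *\<^sub>R w x $ j))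
        = (\<lambda>x. indicator {a<..<b} x *\<^sub>R (w x $ i * w x $ j))"
      by (auto simp: indicator_def)
    finally show "set_borel_measurable lebesgue {a<..<b} (\<lambda>x. w x $ i * w x $ j)"
      unfolding set_borel_measurable_def .
    have "\<bar>w x $ i * w x $ j\<bar> \<le> \<bar>w x \<bullet> w x\<bar>" if "x \<in> {a<..<b}" for x
    proof -
      have "2 * (\<bar>w x $ i\<bar> * \<bar>w x $ j\<bar>) \<le> (w x $ i)\<^sup>2 + (w x $ j)\<^sup>2"
        using sum_squares_bound[of "\<bar>w x $ i\<bar>" "\<bar>w x $ j\<bar>"] by (simp add: mult.assoc)
      then show ?thesis using le[OF that i] le[OF that j] by (simp add: abs_mult)
    qed
    then show "AE x in lebesgue. x \<in> {a<..<b} \<longrightarrow> norm (w x $ i * w x $ j) \<le> norm (w x \<bullet> w x)"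
      by auto
  qed
qed

section \<open>The kernel as a sum of separated monomials\<close>

text \<open>
  The exponents of the first and the second variable in row \<open>q\<close> of \<open>Z\<^sub>2\<close>. The Kronecker factor repeats
  every monomial in \<open>n\<close> consecutive rows.
\<close>

definition row_xdeg :: "nat \<Rightarrow> nat \<Rightarrow> nat \<Rightarrow> nat" where
  "row_xdeg n d q = fst (exponents2 d ! (q div n))"

definition row_ydeg :: "nat \<Rightarrow> nat \<Rightarrow> nat \<Rightarrow> nat" where
  "row_ydeg n d q = snd (exponents2 d ! (q div n))"

text \<open>
  The expansion of \<open>v\<^sup>T N(x,y) u\<close>: in each summand the left factor depends on \<open>x\<close> and \<open>v\<close>, the right one
  on \<open>y\<close> and \<open>u\<close>. In the \<open>P\<^sub>2\<^sub>1\<close> term the arguments of \<open>Z\<^sub>2\<close> are swapped, so its second exponent goes to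
  \<open>x\<close> and its first exponent joins the power of \<open>y\<close> from \<open>Z\<^sub>1\<close>. In the \<open>P\<^sub>2\<^sub>2\<close> term the first exponents of
  the two factors \<open>Z\<^sub>2\<close> combine in the integral over \<open>z\<close>. The vector \<open>v\<close> is arbitrary, rather than
  \<open>w(x)\<close>, so that the lemma also gives the integrability in \<open>y\<close> that \<open>scalar_prod_vec_integral\<close> asks for.
\<close>

lemma separable_kernel_form:
  fixes n d :: nat and a b x y :: real and P12 P21 P22 :: "real mat" and u v :: "real vec"
  defines "r \<equiv> n * (d + 1)" and "s \<equiv> n * length (exponents2 d)"
    and "e \<equiv> row_xdeg n d" and "f \<equiv> row_ydeg n d"
    and "S \<equiv> \<lambda>k. LINT z:{a<..<b}|lebesgue. z ^ k"
  assumes P: "P12 \<in> carrier_mat r s" "P21 \<in> carrier_mat s r" "P22 \<in> carrier_mat s s"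
    and vu: "v \<in> carrier_vec n" "u \<in> carrier_vec n"
  shows "v \<bullet> ((transpose_mat (Z1 n d x) * P12 * Z2 n d x y
        + transpose_mat (Z2 n d y x) * P21 * Z1 n d y
        + mat_integral n n a b (\<lambda>z. transpose_mat (Z2 n d z x) * P22 * Z2 n d z y)) *\<^sub>v u) =
    (\<Sum>p<r. \<Sum>q<s. (P12 $$ (p, q) * x ^ (p div n + e q) * v $ (p mod n)) * (y ^ f q * u $ (q mod n)))
    + (\<Sum>p<s. \<Sum>q<r. (P21 $$ (p, q) * x ^ f p * v $ (p mod n)) * (y ^ (e p + q div n) * u $ (q mod n)))
    + (\<Sum>p<s. \<Sum>q<s. (P22 $$ (p, q) * S (e p + e q) * x ^ f p * v $ (p mod n)) * (y ^ f q * u $ (q mod n)))"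
proof -
  let ?A = "transpose_mat (Z1 n d x) * P12 * Z2 n d x y"
  let ?B = "transpose_mat (Z2 n d y x) * P21 * Z1 n d y"
  let ?F = "\<lambda>z. transpose_mat (Z2 n d z x) * P22 * Z2 n d z y"
  let ?C = "mat_integral n n a b ?F"
  note Z = Z1_carrier[of n d, folded r_def] Z2_carrier[of n d, folded s_def]
  note Zm = Z1_mult_vec[of _ n _ d, folded r_def]
    Z2_mult_vec[of _ n _ d, folded s_def, folded row_xdeg_def row_ydeg_def, folded e_def f_def]
  have A: "?A \<in> carrier_mat n n" and B: "?B \<in> carrier_mat n n" and F: "\<And>z. ?F z \<in> carrier_mat n n"
    using P Z by (auto intro!: mult_carrier_mat)
  have C: "?C \<in> carrier_mat n n"
    by (simp add: mat_integral_def)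
  have "v \<bullet> ((?A + ?B + ?C) *\<^sub>v u) = v \<bullet> (?A *\<^sub>v u) + v \<bullet> (?B *\<^sub>v u) + v \<bullet> (?C *\<^sub>v u)"
    using A B C vu
    by (simp add: add_mult_distrib_mat_vec[where nr = n and nc = n] scalar_prod_add_distrib[where n = n])
  moreover have "v \<bullet> (?A *\<^sub>v u) =
      (\<Sum>p<r. \<Sum>q<s. (P12 $$ (p, q) * x ^ (p div n + e q) * v $ (p mod n)) * (y ^ f q * u $ (q mod n)))"
    using P Z vu
    by (simp add: scalar_prod_congruence[OF P(1) Z(1) Z(2)] Zm power_add mult_ac)
  moreover have "v \<bullet> (?B *\<^sub>v u) =
      (\<Sum>p<s. \<Sum>q<r. (P21 $$ (p, q) * x ^ f p * v $ (p mod n)) * (y ^ (e p + q div n) * u $ (q mod n)))"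
    using P Z vu
    by (simp add: scalar_prod_congruence[OF P(2) Z(2) Z(1)] Zm power_add mult_ac)
  moreover have "v \<bullet> (?C *\<^sub>v u) =
      (\<Sum>p<s. \<Sum>q<s. (P22 $$ (p, q) * S (e p + e q) * x ^ f p * v $ (p mod n)) * (y ^ f q * u $ (q mod n)))"
  proof -
    have form: "v' \<bullet> (?F z *\<^sub>v u') = (\<Sum>p<s. \<Sum>q<s.
        (P22 $$ (p, q) * x ^ f p * v' $ (p mod n) * (y ^ f q * u' $ (q mod n))) * z ^ (e p + e q))"
      if "v' \<in> carrier_vec n" "u' \<in> carrier_vec n" for v' u' z
      using P Z that
      by (simp add: scalar_prod_congruence[OF P(3) Z(2) Z(2)] Zm power_add mult_ac)
    have int: "set_integrable lebesgue {a<..<b} (\<lambda>z. z ^ k)" for k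
      using power_set_integrable[OF set_integrable_one, of a b k] by simp
    have "v \<bullet> (?C *\<^sub>v u) = (LINT z:{a<..<b}|lebesgue. v \<bullet> (?F z *\<^sub>v u))"
      using F vu form int
      by (intro scalar_prod_mat_integral) (auto intro!: set_integral_double_sum(1))
    also have "\<dots> = (\<Sum>p<s. \<Sum>q<s.
        (P22 $$ (p, q) * x ^ f p * v $ (p mod n) * (y ^ f q * u $ (q mod n))) * S (e p + e q))"
      using int unfolding form[OF vu] S_def by (intro set_integral_double_sum(2)) auto
    finally show ?thesis by (simp add: mult_ac)
  qed
  ultimately show ?thesis by simp
qed

section \<open>Coercivity of the functional\<close>

theorem theorem2:
  fixes n d :: nat and a b \<epsilon> :: real
    and P P11 P12 P21 P22 :: "real mat"
    and M :: "real \<Rightarrow> real mat" and N :: "real \<Rightarrow> real \<Rightarrow> real mat"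
    and V :: "(real \<Rightarrow> real vec) \<Rightarrow> real"
  assumes "n \<ge> 1" and "a < b" and "\<epsilon> > 0"
    and "P \<in> sym_mats (n * (d + 1) * (d + 4) div 2)"
    and "pos_semidef P"
    and "split_block P (n * (d + 1)) (n * (d + 1)) = (P11, P12, P21, P22)"
    and "\<And>x. x \<in> {a<..<b} \<Longrightarrow>
      M x = transpose_mat (Z1 n d x) * P11 * Z1 n d x + \<epsilon> \<cdot>\<^sub>m 1\<^sub>m n"
    and "\<And>x y. x \<in> {a<..<b} \<Longrightarrow> y \<in> {a<..<b} \<Longrightarrow>
      N x y = transpose_mat (Z1 n d x) * P12 * Z2 n d x y
        + transpose_mat (Z2 n d y x) * P21 * Z1 n d y
        + mat_integral n n a b (\<lambda>z. transpose_mat (Z2 n d z x) * P22 * Z2 n d z y)"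
    and "\<And>w. w \<in> L2_space n a b \<Longrightarrow> V w = quadratic_functional n a b M N w"
  shows "\<forall>w \<in> L2_space n a b. V w \<ge> \<epsilon> * (L2_norm a b w)\<^sup>2"
proof
  fix w assume w: "w \<in> L2_space n a b"
  define r where "r = n * (d + 1)"
  define s where "s = n * length (exponents2 d)"
  define e where "e = row_xdeg n d"
  define f where "f = row_ydeg n d"
  define S where "S = (\<lambda>k. LINT z:{a<..<b}|lebesgue. z ^ k)"
  define J where "J = (\<lambda>k i. LINT y:{a<..<b}|lebesgue. y ^ k * w y $ i)"
  note Z = Z1_carrier[of n d, folded r_def]
  note Zm = Z1_mult_vec[of _ n _ d, folded r_def]
  note M = assms(7) and N = assms(8)

  have "2 * length (exponents2 d) = (d + 1) * (d + 2)"
    by (simp add: length_exponents2)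
  then have "n * (d + 1) * (d + 4) = 2 * (r + s)"
    unfolding r_def s_def by (simp add: algebra_simps)
  then have dims: "dim_row P = r + s" "dim_col P = r + s"
    using assms(4) unfolding sym_mats_def by auto
  note P = split_block[OF assms(6)[folded r_def] dims]

  have wc: "w x \<in> carrier_vec n" if "x \<in> {a<..<b}" for x
    using w that unfolding L2_space_def by auto
  have sq: "set_integrable lebesgue {a<..<b} (\<lambda>x. w x \<bullet> w x)"
    using w unfolding L2_space_def by auto
  have mod: "p mod n < n" for p
    using assms(1) by simp
  have int0: "set_integrable lebesgue {a<..<b} (\<lambda>z. z ^ k)" for k
    using power_set_integrable[OF set_integrable_one, of a b k] by simp
  have int1: "set_integrable lebesgue {a<..<b} (\<lambda>x. x ^ k * w x $ (p mod n))" for k p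
    by (intro power_set_integrable L2_component_integrable[OF w] mod)
  have int2: "set_integrable lebesgue {a<..<b} (\<lambda>x. x ^ k * (w x $ (p mod n) * w x $ (q mod n)))" for k p q
    by (intro power_set_integrable L2_component_product_integrable[OF w mod mod])

  \<comment> \<open>\<open>A\<close>, \<open>B\<close>, \<open>C'\<close>, \<open>D'\<close> are the four block terms of the form of \<open>P\<close> at \<open>u(x)\<close> and \<open>v(x)\<close>; \<open>B\<close>, \<open>C\<close>, \<open>D\<close> are
    the three parts of \<open>w(x)\<^sup>T \<integral> N(x,y) w(y) dy\<close>.\<close>
  define A where "A x = (\<Sum>p<r. \<Sum>q<r. P11 $$ (p, q) * (x ^ (p div n + q div n) * (w x $ (p mod n) * w x $ (q mod n))))" for x
  define B where "B x = (\<Sum>p<r. \<Sum>q<s. (P12 $$ (p, q) * J (f q) (q mod n)) * (x ^ (p div n + e q) * w x $ (p mod n)))" for x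
  define C where "C x = (\<Sum>p<s. \<Sum>q<r. (P21 $$ (p, q) * J (e p + q div n) (q mod n)) * (x ^ f p * w x $ (p mod n)))" for x
  define D where "D x = (\<Sum>p<s. \<Sum>q<s. (P22 $$ (p, q) * S (e p + e q) * J (f q) (q mod n)) * (x ^ f p * w x $ (p mod n)))" for x
  define C' where "C' x = (\<Sum>p<s. \<Sum>q<r. (P21 $$ (p, q) * J (f p) (p mod n)) * (x ^ (e p + q div n) * w x $ (q mod n)))" for x
  define D' where "D' x = (\<Sum>p<s. \<Sum>q<s. (P22 $$ (p, q) * (J (f p) (p mod n) * J (f q) (q mod n))) * x ^ (e p + e q))" for x

  have int: "set_integrable lebesgue {a<..<b} A" "set_integrable lebesgue {a<..<b} B"
    "set_integrable lebesgue {a<..<b} C" "set_integrable lebesgue {a<..<b} D"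
    "set_integrable lebesgue {a<..<b} C'" "set_integrable lebesgue {a<..<b} D'"
    unfolding A_def B_def C_def D_def C'_def D'_def
    by (intro set_integral_double_sum(1) int0 int1 int2)+
  \<comment> \<open>The exchange of integrals: in each equation both sides are the same sum of products of moments.\<close>
  have CC': "(LINT x:{a<..<b}|lebesgue. C x) = (LINT x:{a<..<b}|lebesgue. C' x)"
    unfolding C_def C'_def
    by (subst (1 2) set_integral_double_sum(2)[OF int1], unfold J_def, simp add: mult_ac)
  have DD': "(LINT x:{a<..<b}|lebesgue. D x) = (LINT x:{a<..<b}|lebesgue. D' x)"
    unfolding D_def D'_def
    by (subst set_integral_double_sum(2)[OF int1], subst set_integral_double_sum(2)[OF int0],
        unfold J_def S_def, simp add: mult_ac)

  have multiplier: "w x \<bullet> (M x *\<^sub>v w x) = A x + \<epsilon> * (w x \<bullet> w x)" if x: "x \<in> {a<..<b}" for x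
  proof -
    have "(\<epsilon> \<cdot>\<^sub>m 1\<^sub>m n) *\<^sub>v w x = \<epsilon> \<cdot>\<^sub>v w x"
      using wc[OF x] by (intro eq_vecI) auto
    moreover have "transpose_mat (Z1 n d x) * P11 * Z1 n d x \<in> carrier_mat n n"
      using P(1) Z by (auto intro!: mult_carrier_mat)
    ultimately have "w x \<bullet> (M x *\<^sub>v w x) =
        w x \<bullet> ((transpose_mat (Z1 n d x) * P11 * Z1 n d x) *\<^sub>v w x) + w x \<bullet> (\<epsilon> \<cdot>\<^sub>v w x)"
      using wc[OF x] unfolding M[OF x]
      by (subst add_mult_distrib_mat_vec[where nr = n and nc = n])
        (auto simp: scalar_prod_add_distrib[where n = n])
    then show ?thesis
      using P(1) Z wc[OF x] unfolding A_def
      by (simp add: scalar_prod_congruence[OF P(1) Z Z] Zm power_add mult_ac)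
  qed

  have kernel: "w x \<bullet> vec_integral n a b (\<lambda>y. N x y *\<^sub>v w y) = B x + C x + D x" if x: "x \<in> {a<..<b}" for x
  proof -
    let ?B = "\<lambda>v y. (\<Sum>p<r. \<Sum>q<s. (P12 $$ (p, q) * x ^ (p div n + e q) * v $ (p mod n)) * (y ^ f q * w y $ (q mod n)))"
    let ?C = "\<lambda>v y. (\<Sum>p<s. \<Sum>q<r. (P21 $$ (p, q) * x ^ f p * v $ (p mod n)) * (y ^ (e p + q div n) * w y $ (q mod n)))"
    let ?D = "\<lambda>v y. (\<Sum>p<s. \<Sum>q<s. (P22 $$ (p, q) * S (e p + e q) * x ^ f p * v $ (p mod n)) * (y ^ f q * w y $ (q mod n)))"
    have form: "v \<bullet> (N x y *\<^sub>v w y) = ?B v y + ?C v y + ?D v y"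
      if "y \<in> {a<..<b}" "v \<in> carrier_vec n" for v y
      unfolding N[OF x that(1)] r_def s_def e_def f_def S_def
      by (rule separable_kernel_form) (use P that wc in \<open>auto simp: r_def s_def\<close>)
    have ints: "set_integrable lebesgue {a<..<b} (?B v)" "set_integrable lebesgue {a<..<b} (?C v)"
      "set_integrable lebesgue {a<..<b} (?D v)" for v
      by (intro set_integral_double_sum(1) int1)+
    have "set_integrable lebesgue {a<..<b} (\<lambda>y. v \<bullet> (N x y *\<^sub>v w y))" if "v \<in> carrier_vec n" for v
    proof -
      have "set_integrable lebesgue {a<..<b} (\<lambda>y. ?B v y + ?C v y + ?D v y)"
        by (intro set_integral_add ints)
      then show ?thesis
        using form[OF _ that] by (subst set_integrable_cong[OF refl refl]) auto
    qed
    moreover have "N x y *\<^sub>v w y \<in> carrier_vec n" if "y \<in> {a<..<b}" for y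
      by (rule mult_mat_vec_carrier[OF _ wc[OF that]])
        (auto simp: N[OF x that] mat_integral_def intro!: add_carrier_mat)
    ultimately have "w x \<bullet> vec_integral n a b (\<lambda>y. N x y *\<^sub>v w y) =
        (LINT y:{a<..<b}|lebesgue. w x \<bullet> (N x y *\<^sub>v w y))"
      using wc[OF x] by (intro scalar_prod_vec_integral) auto
    also have "\<dots> = (LINT y:{a<..<b}|lebesgue. ?B (w x) y + ?C (w x) y + ?D (w x) y)"
      using form[OF _ wc[OF x]] by (intro set_lebesgue_integral_cong) auto
    also have "\<dots> = (LINT y:{a<..<b}|lebesgue. ?B (w x) y) + (LINT y:{a<..<b}|lebesgue. ?C (w x) y)
        + (LINT y:{a<..<b}|lebesgue. ?D (w x) y)"
      by (simp only: set_integral_add ints)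
    also have "\<dots> = B x + C x + D x"
      unfolding B_def C_def D_def set_integral_double_sum(2)[OF int1] J_def
      by (simp add: mult_ac)
    finally show ?thesis .
  qed

  have "V w = (LINT x:{a<..<b}|lebesgue. w x \<bullet> (M x *\<^sub>v w x))
      + (LINT x:{a<..<b}|lebesgue. w x \<bullet> vec_integral n a b (\<lambda>y. N x y *\<^sub>v w y))"
    using assms(9)[OF w] unfolding quadratic_functional_def .
  also have "\<dots> = (LINT x:{a<..<b}|lebesgue. A x + \<epsilon> * (w x \<bullet> w x))
      + (LINT x:{a<..<b}|lebesgue. B x + C x + D x)"
    using multiplier kernel by (intro arg_cong2[where f = "(+)"] set_lebesgue_integral_cong) auto
  also have "\<dots> = \<epsilon> * (LINT x:{a<..<b}|lebesgue. w x \<bullet> w x)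
      + (LINT x:{a<..<b}|lebesgue. A x + B x + C' x + D' x)"
    using int sq CC' DD' by (simp add: set_integral_add)
  finally have V: "V w = \<dots>" .

  have "0 \<le> A x + B x + C' x + D' x" if x: "x \<in> {a<..<b}" for x
  proof -
    define u where "u = Z1 n d x *\<^sub>v w x"
    \<comment> \<open>The vector \<open>\<integral> Z\<^sub>2(x,y) w(y) dy\<close> with its integral evaluated in moments.\<close>
    define v where "v = Matrix.vec s (\<lambda>q. x ^ e q * J (f q) (q mod n))"
    have uv: "u \<in> carrier_vec r" "v \<in> carrier_vec s"
      unfolding u_def v_def using mult_mat_vec_carrier[OF Z wc[OF x]] by auto
    have u: "u $ p = x ^ (p div n) * w x $ (p mod n)" if "p < r" for p
      unfolding u_def by (rule Zm[OF wc[OF x] that])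
    have v: "v $ q = x ^ e q * J (f q) (q mod n)" if "q < s" for q
      unfolding v_def using that by simp
    have "0 \<le> u \<bullet> (P11 *\<^sub>v u) + u \<bullet> (P12 *\<^sub>v v) + v \<bullet> (P21 *\<^sub>v u) + v \<bullet> (P22 *\<^sub>v v)"
      using pos_semidef_four_block[of P11 P12 P21 P22] assms(5) P uv by simp
    also have "u \<bullet> (P11 *\<^sub>v u) = A x"
      unfolding A_def scalar_prod_mult_mat_vec[OF P(1) uv(1) uv(1)]
      by (simp add: u v power_add mult_ac)
    also have "u \<bullet> (P12 *\<^sub>v v) = B x"
      unfolding B_def scalar_prod_mult_mat_vec[OF P(2) uv]
      by (simp add: u v power_add mult_ac)
    also have "v \<bullet> (P21 *\<^sub>v u) = C' x"
      unfolding C'_def scalar_prod_mult_mat_vec[OF P(3) uv(2,1)]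
      by (simp add: u v power_add mult_ac)
    also have "v \<bullet> (P22 *\<^sub>v v) = D' x"
      unfolding D'_def scalar_prod_mult_mat_vec[OF P(4) uv(2,2)]
      by (simp add: v power_add mult_ac)
    finally show ?thesis .
  qed
  then have "0 \<le> (LINT x:{a<..<b}|lebesgue. A x + B x + C' x + D' x)"
    unfolding set_lebesgue_integral_def
    by (intro Bochner_Integration.integral_nonneg) (auto simp: indicator_def)
  moreover have "(L2_norm a b w)\<^sup>2 = (LINT x:{a<..<b}|lebesgue. w x \<bullet> w x)"
    unfolding L2_norm_def set_lebesgue_integral_def
    by (intro real_sqrt_pow2 Bochner_Integration.integral_nonneg)
      (auto simp: indicator_def scalar_prod_def intro!: sum_nonneg)
  ultimately show "V w \<ge> \<epsilon> * (L2_norm a b w)\<^sup>2"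
    using V by simp
qed

end
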